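(* Let $N\ge 1$ and let $\rho\in\{321,312\}$. For each $1\le k\le N$, the number of $\rho$-avoiding permutations in $\mathfrak{S}_N$ with exactly $k$ left-to-right maxima is the Narayana number $T(N,k)=\frac1k\binom{N-1}{k-1}\binom{N}{k-1}$. The expected number of left-to-right maxima of a uniformly random $\rho$-avoiding permutation in $\mathfrak{S}_N$ is $$\frac{(2N-1)C_{N-1}}{C_N}=\frac{N+1}{2},$$ and the win probability of the strategy-indifferent game of best choice of rank $N+1$ whose bine of competitors is the set of $\rho$-avoiding permutations in $\mathfrak{S}_N$ tends to $0$ as $N\to\infty$.
   Context: $\mathfrak{S}_n$ is the set of permutations of $\{1,\dots,n\}$ in one-line notation; $C_n=\frac{1}{n+1}\binom{2n}{n}$ is the $n$th Catalan number. A permutation avoids a pattern $\rho\in\mathfrak{S}_3$ if it has no (not necessarily consecutive) subsequence of length 3 with the same relative order as $\rho$. An entry $\pi_j$ is a left-to-right maximum if $\pi_i<\pi_j$ for all $i<j$; then $j$ is a left-to-right maximum position. The flattening of a sequence of $i$ distinct integers is the unique permutation of $\{1,\dots,i\}$ with the same relative order; $\pi|_{[i]}$ denotes the flattening of $\pi_1,\dots,\pi_i$. Game of best choice of rank $n$ defined by a nonempty finite multiset $\mathcal{I}$ of elements of $\mathfrak{S}_n$: $\pi\in\mathcal{I}$ is chosen uniformly at random (with multiplicity) and $\pi|_{[1]},\pi|_{[2]},\dots$ are presented sequentially. A strategy is given by a strike set $A$ of prefixes: the player stops at the first $i$ with $\pi|_{[i]}\in A$, and wins if and only if such $i$ exists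 and $\pi_i=n$. The prefix tree $\mathcal{P}_n$ is the set of permutations in $\bigcup_{i=1}^n\mathfrak{S}_i$ whose last entry is a left-to-right maximum, ordered by: $q$ contains $p$ if $q|_{[i]}=p$, where $i$ is the size of $p$. A maximal antichain of $\mathcal{P}_n$ is a set of pairwise incomparable elements such that every element of $\mathcal{P}_n$ is comparable to some element of it. The game is strategy-indifferent if all strike sets that are maximal antichains of $\mathcal{P}_n$ have the same probability of winning, called the win probability. For a finite nonempty multiset $\mathcal{J}'$ of elements of $\mathfrak{S}_{n-1}$, a strategy-indifferent game of rank $n$ with bine of competitors $\mathcal{J}'$ is a multiset $\mathcal{I}$ constructed as follows: let $\mathcal{J}$ be obtained by appending $n$ to each element of $\mathcal{J}'$; for each $\pi\in\mathcal{J}$ and each left-to-right maximum position $i$ of $\pi$, include in $\mathcal{I}$ one permutation $\widetilde\pi\in\mathfrak{S}_n$ with $\widetilde\pi|_{[i]}=\pi|_{[i]}$ and $\widetilde\pi_i=n$ (arbitrary choice; the win probability does not depend on the choices). *)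

theory Defs
  imports
    Complex_Main
    "HOL-Library.Multiset"
    "HOL-Library.Sublist"
    "HOL-Combinatorics.Multiset_Permutations"
    "HOL-Probability.Probability_Mass_Function"
begin

(* Permutations in one-line notation are lists of natural numbers.  Positions are 1-based, so the
   entry at position i of p is p ! (i - 1). *)

abbreviation perms :: "nat \<Rightarrow> nat list set" where
  "perms n \<equiv> permutations_of_set {1..n}"

definition flatten :: "nat list \<Rightarrow> nat list" where
  "flatten xs = map (\<lambda>x. card {y \<in> set xs. y \<le> x}) xs"

definition prefix_pattern :: "nat \<Rightarrow> nat list \<Rightarrow> nat list" where
  "prefix_pattern i \<pi> = flatten (take i \<pi>)"

(* For distinct ys, flatten ys = \<rho> says that ys has the same relative order as the
   permutation \<rho>; subseq does not require the subsequence to be contiguous. *)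
definition avoids :: "nat list \<Rightarrow> nat list \<Rightarrow> bool" where
  "avoids \<pi> \<rho> \<longleftrightarrow> (\<forall>ys. subseq ys \<pi> \<longrightarrow> flatten ys \<noteq> \<rho>)"

definition avoiders :: "nat list \<Rightarrow> nat \<Rightarrow> nat list set" where
  "avoiders \<rho> n = {\<pi> \<in> perms n. avoids \<pi> \<rho>}"

definition ltr_max_positions :: "nat list \<Rightarrow> nat set" where
  "ltr_max_positions \<pi> = {j \<in> {1..length \<pi>}. \<forall>i\<in>{1..<j}. \<pi> ! (i - 1) < \<pi> ! (j - 1)}"

definition num_ltr_max :: "nat list \<Rightarrow> nat" where
  "num_ltr_max \<pi> = card (ltr_max_positions \<pi>)"

definition catalan :: "nat \<Rightarrow> real" where
  "catalan n = 1 / (real n + 1) * real ((2 * n) choose n)"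

definition narayana :: "nat \<Rightarrow> nat \<Rightarrow> real" where
  "narayana N k = 1 / real k * real ((N - 1) choose (k - 1)) * real (N choose (k - 1))"

definition best_choice_game :: "nat \<Rightarrow> nat list multiset \<Rightarrow> bool" where
  "best_choice_game n \<I> \<longleftrightarrow> \<I> \<noteq> {#} \<and> set_mset \<I> \<subseteq> perms n"

definition wins :: "nat \<Rightarrow> nat list set \<Rightarrow> nat list \<Rightarrow> bool" where
  "wins n A \<pi> \<longleftrightarrow>
     (\<exists>i\<in>{1..n}. prefix_pattern i \<pi> \<in> A \<and> (\<forall>j\<in>{1..<i}. prefix_pattern j \<pi> \<notin> A)
        \<and> \<pi> ! (i - 1) = n)"

definition strike_win_prob :: "nat \<Rightarrow> nat list multiset \<Rightarrow> nat list set \<Rightarrow> real" where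
  "strike_win_prob n \<I> A = measure_pmf.prob (pmf_of_multiset \<I>) {\<pi>. wins n A \<pi>}"

definition prefix_tree :: "nat \<Rightarrow> nat list set" where
  "prefix_tree n = {p \<in> (\<Union>i\<in>{1..n}. perms i). length p \<in> ltr_max_positions p}"

definition contains :: "nat list \<Rightarrow> nat list \<Rightarrow> bool" where
  "contains q p \<longleftrightarrow> length p \<le> length q \<and> prefix_pattern (length p) q = p"

definition comparable :: "nat list \<Rightarrow> nat list \<Rightarrow> bool" where
  "comparable p q \<longleftrightarrow> contains p q \<or> contains q p"

definition maximal_antichain :: "nat \<Rightarrow> nat list set \<Rightarrow> bool" where
  "maximal_antichain n A \<longleftrightarrow> A \<subseteq> prefix_tree n
     \<and> (\<forall>p\<in>A. \<forall>q\<in>A. p \<noteq> q \<longrightarrow> \<not> comparable p q)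
     \<and> (\<forall>p\<in>prefix_tree n. \<exists>q\<in>A. comparable p q)"

definition strategy_indifferent :: "nat \<Rightarrow> nat list multiset \<Rightarrow> bool" where
  "strategy_indifferent n \<I> \<longleftrightarrow> best_choice_game n \<I>
     \<and> (\<exists>w. \<forall>A. maximal_antichain n A \<longrightarrow> strike_win_prob n \<I> A = w)"

(* Meaningful only for strategy-indifferent games. *)
definition win_probability :: "nat \<Rightarrow> nat list multiset \<Rightarrow> real" where
  "win_probability n \<I> = (THE w. \<forall>A. maximal_antichain n A \<longrightarrow> strike_win_prob n \<I> A = w)"

(* The pairs (\<pi>, i) with \<pi> in the multiset J of the competitors with n appended and i a
   left-to-right maximum position of \<pi>. *)
definition bine_pairs :: "nat \<Rightarrow> nat list multiset \<Rightarrow> (nat list \<times> nat) multiset" where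
  "bine_pairs n \<J>' =
     (\<Sum>\<pi>\<in>#image_mset (\<lambda>\<pi>. \<pi> @ [n]) \<J>'. image_mset (Pair \<pi>) (mset_set (ltr_max_positions \<pi>)))"

(* rel_mset matches the occurrences of pairs in the first multiset bijectively with the
   occurrences of permutations in the second, so the choice of the permutation is free and
   separate for every occurrence. *)
definition bine_game :: "nat \<Rightarrow> nat list multiset \<Rightarrow> nat list multiset \<Rightarrow> bool" where
  "bine_game n \<J>' \<I> \<longleftrightarrow> \<J>' \<noteq> {#} \<and> set_mset \<J>' \<subseteq> perms (n - 1)
     \<and> rel_mset
         (\<lambda>(\<pi>, i) \<sigma>. \<sigma> \<in> perms n \<and> prefix_pattern i \<sigma> = prefix_pattern i \<pi> \<and> \<sigma> ! (i - 1) = n)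
         (bine_pairs n \<J>') \<I>"

end

(* For \<rho> = 321 (\<rho> = 312), a permutation avoids \<rho> iff every entry that is not a left-to-right
   maximum is the smallest (largest) unused value below the current maximum.  Reading left to right,
   the number of ways to continue therefore depends only on the numbers r and s of unused values
   below and above the current maximum and on the number k of maxima still to come.  In lattice
   path terms this is C(s-1,k-1) C(r+s,k) - C(s-1,k) C(r+s,k-1), which at r = 0 is the Narayana
   number.  The expectation follows from the symmetry k -> N+1-k of the Narayana numbers.
   In a game with a bine of competitors, a maximal antichain contains exactly one prefix of each
   competitor with n appended, so exactly one of the permutations generated by it wins; hence the
   win probability is 1 / (E + 1), with E the expected number of left-to-right maxima of a competitor. *)
theory Submission
  imports Defs "HOL-Real_Asymp.Real_Asymp"
begin

subsection \<open>Pattern avoidance and left-to-right maxima along the list\<close>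

text \<open>Here \<open>m\<close> plays the running maximum, and \<open>R\<close> is the order
  required of two entries that lie below it: \<open><\<close> encodes avoidance of 321 and
  \<open>>\<close> avoidance of 312, so that one development serves both patterns.\<close>

fun rel_avoiding :: "(nat \<Rightarrow> nat \<Rightarrow> bool) \<Rightarrow> nat \<Rightarrow> nat list \<Rightarrow> bool" where
  "rel_avoiding R m [] \<longleftrightarrow> True"
| "rel_avoiding R m (x # xs) \<longleftrightarrow>
     (if m < x then rel_avoiding R x xs else (\<forall>y\<in>set xs. x < m \<longrightarrow> y < m \<longrightarrow> R x y) \<and> rel_avoiding R m xs)"

fun records_above :: "nat \<Rightarrow> nat list \<Rightarrow> nat" where
  "records_above m [] = 0"
| "records_above m (x # xs) = (if m < x then Suc (records_above x xs) else records_above m xs)"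

lemma subseq_pair_Cons: "subseq [b, c] (x # xs) \<longleftrightarrow> b = x \<and> c \<in> set xs \<or> subseq [b, c] xs"
  by (auto simp: subseq_singleton_left elim: list_emb_Cons_iff1 dest: subseq_Cons')

lemma subseq_triple_Cons:
  "subseq [a, b, c] (x # xs) \<longleftrightarrow> a = x \<and> subseq [b, c] xs \<or> subseq [a, b, c] xs"
  by (auto dest: subseq_Cons')

text \<open>In a violating triple the first entry can be raised to the running maximum before the
  second entry, since this only weakens b < a and c < a. Hence testing each entry against the
  running maximum alone, as the recursion does, detects every violation.\<close>

lemma rel_avoiding_iff:
  "rel_avoiding R m xs \<longleftrightarrow>
     (\<forall>a b c. subseq [a, b, c] (m # xs) \<longrightarrow> b < a \<longrightarrow> c < a \<longrightarrow> R b c)"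
proof (induction xs arbitrary: m)
  case Nil
  then show ?case by (auto simp: subseq_triple_Cons)
next
  case (Cons x xs)
  define P where "P ys \<longleftrightarrow> (\<forall>a b c. subseq [a, b, c] ys \<longrightarrow> b < a \<longrightarrow> c < a \<longrightarrow> R b c)" for ys
  have PI: "P ys" if "\<And>a b c. \<lbrakk>subseq [a, b, c] ys; b < a; c < a\<rbrakk> \<Longrightarrow> R b c" for ys
    using that by (auto simp: P_def)
  have PD: "R b c" if "P ys" "subseq [a, b, c] ys" "b < a" "c < a" for ys a b c
    using that unfolding P_def by blast
  have IH: "rel_avoiding R n xs \<longleftrightarrow> P (n # xs)" for n
    using Cons.IH by (simp add: P_def)
  have "rel_avoiding R m (x # xs) \<longleftrightarrow> P (m # x # xs)"
  proof (cases "m < x")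
    case True
    have "P (m # x # xs) \<longleftrightarrow> P (x # xs)"
    proof (intro iffI PI)
      fix a b c assume "P (m # x # xs)" "subseq [a, b, c] (x # xs)" "b < a" "c < a"
      then show "R b c" using PD[of "m # x # xs" a b c] subseq_triple_Cons by blast
    next
      fix a b c assume P: "P (x # xs)" and abc: "subseq [a, b, c] (m # x # xs)" "b < a" "c < a"
      \<comment> \<open>A triple starting at \<open>m\<close> cannot have \<open>x\<close> as its
        middle entry because m < x, so its first entry can be replaced by \<open>x\<close>.\<close>
      have "subseq [a, b, c] (x # xs) \<or> subseq [x, b, c] (x # xs) \<and> b < x \<and> c < x"
        using abc True unfolding subseq_triple_Cons subseq_pair_Cons by auto
      then show "R b c" using PD[OF P, of a b c] PD[OF P, of x b c] abc(2,3) by blast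
    qed
    then show ?thesis using True IH by simp
  next
    case False
    have "P (m # x # xs) \<longleftrightarrow> (\<forall>y\<in>set xs. x < m \<longrightarrow> y < m \<longrightarrow> R x y) \<and> P (m # xs)"
    proof (intro iffI conjI ballI impI PI)
      fix y assume "P (m # x # xs)" "y \<in> set xs" "x < m" "y < m"
      then show "R x y"
        using PD[of "m # x # xs" m x y] unfolding subseq_triple_Cons subseq_pair_Cons by auto
    next
      fix a b c assume "P (m # x # xs)" "subseq [a, b, c] (m # xs)" "b < a" "c < a"
      then show "R b c"
        using PD[of "m # x # xs" a b c] unfolding subseq_triple_Cons subseq_pair_Cons by auto
    next
      fix a b c assume P: "(\<forall>y\<in>set xs. x < m \<longrightarrow> y < m \<longrightarrow> R x y) \<and> P (m # xs)"
        and abc: "subseq [a, b, c] (m # x # xs)" "b < a" "c < a"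
      \<comment> \<open>A triple starting at \<open>x\<close> may start at \<open>m\<close> instead,
        since x <= m. The only other triples that use \<open>x\<close> are (m, x, c), which the
        explicit condition of the recursion covers.\<close>
      have "subseq [a, b, c] (m # xs) \<or> a = m \<and> b = x \<and> c \<in> set xs
          \<or> subseq [m, b, c] (m # xs) \<and> b < m \<and> c < m"
        using abc False unfolding subseq_triple_Cons subseq_pair_Cons by auto
      then show "R b c"
        using PD[OF conjunct2[OF P], of a b c] PD[OF conjunct2[OF P], of m b c] P abc(2,3) by blast
    qed
    then show ?thesis using False IH by simp
  qed
  then show ?case by (simp add: P_def)
qed

lemma flatten_triple_iff:
  assumes "distinct [a, b, c :: nat]"
  shows "flatten [a, b, c] = [3, 2, 1] \<longleftrightarrow> c < b \<and> b < a"
    and "flatten [a, b, c] = [3, 1, 2] \<longleftrightarrow> b < c \<and> c < a"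
proof -
  \<comment> \<open>Conditional singletons let the three ranks be computed by case
    distinction.\<close>
  have eq: "{y \<in> set [a, b, c]. y \<le> x} =
      (if a \<le> x then {a} else {}) \<union> (if b \<le> x then {b} else {}) \<union> (if c \<le> x then {c} else {})" for x
    by auto
  show "flatten [a, b, c] = [3, 2, 1] \<longleftrightarrow> c < b \<and> b < a"
    "flatten [a, b, c] = [3, 1, 2] \<longleftrightarrow> b < c \<and> c < a"
    using assms unfolding flatten_def eq by (auto simp: card_insert_if split: if_splits)
qed

lemma avoids_triple_iff:
  assumes "distinct xs" "length \<rho> = 3"
  shows "avoids xs \<rho> \<longleftrightarrow> (\<forall>a b c. subseq [a, b, c] xs \<longrightarrow> flatten [a, b, c] \<noteq> \<rho>)"
proof
  assume *: "\<forall>a b c. subseq [a, b, c] xs \<longrightarrow> flatten [a, b, c] \<noteq> \<rho>"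
  show "avoids xs \<rho>" unfolding avoids_def
  proof (intro allI impI notI)
    fix ys assume ys: "subseq ys xs" "flatten ys = \<rho>"
    then have "length ys = 3" using assms(2) by (auto simp: flatten_def)
    then obtain a b c where "ys = [a, b, c]" by (auto simp: numeral_3_eq_3 length_Suc_conv)
    with * ys show False by auto
  qed
qed (auto simp: avoids_def)

text \<open>No natural number is below 0, so an initial running maximum 0 can never be the first
  entry of a violating triple.\<close>

lemma rel_avoiding_0_iff:
  "rel_avoiding R 0 xs \<longleftrightarrow> (\<forall>a b c. subseq [a, b, c] xs \<longrightarrow> b < a \<longrightarrow> c < a \<longrightarrow> R b c)"
  unfolding rel_avoiding_iff
proof (intro iffI allI impI)
  fix a b c assume "\<forall>a b c. subseq [a, b, c] (0 # xs) \<longrightarrow> b < a \<longrightarrow> c < a \<longrightarrow> R b c"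
    "subseq [a, b, c] xs" "b < a" "c < a"
  then show "R b c" using subseq_triple_Cons[of a b c 0 xs] by (metis (no_types, lifting))
next
  fix a b c assume "\<forall>a b c. subseq [a, b, c] xs \<longrightarrow> b < a \<longrightarrow> c < a \<longrightarrow> R b c"
    "subseq [a, b, c] (0 # xs)" "b < a" "c < a"
  then show "R b c" using subseq_triple_Cons[of a b c 0 xs] by (metis less_nat_zero_code)
qed

lemma avoids_321_iff:
  assumes "distinct xs"
  shows "avoids xs [3, 2, 1] \<longleftrightarrow> rel_avoiding (<) 0 xs"
proof -
  have "flatten [a, b, c] \<noteq> [3, 2, 1] \<longleftrightarrow> (b < a \<longrightarrow> c < a \<longrightarrow> b < c)" if "subseq [a, b, c] xs" for a b c
  proof -
    have "distinct [a, b, c]" using that assms by (metis subseq_conv_nths distinct_nthsI)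
    then show ?thesis using flatten_triple_iff(1)[of a b c] by auto
  qed
  then show ?thesis
    using assms by (simp add: avoids_triple_iff rel_avoiding_0_iff)
qed

lemma avoids_312_iff:
  assumes "distinct xs"
  shows "avoids xs [3, 1, 2] \<longleftrightarrow> rel_avoiding (>) 0 xs"
proof -
  have "flatten [a, b, c] \<noteq> [3, 1, 2] \<longleftrightarrow> (b < a \<longrightarrow> c < a \<longrightarrow> b > c)" if "subseq [a, b, c] xs" for a b c
  proof -
    have "distinct [a, b, c]" using that assms by (metis subseq_conv_nths distinct_nthsI)
    then show ?thesis using flatten_triple_iff(2)[of a b c] by auto
  qed
  then show ?thesis
    using assms by (simp add: avoids_triple_iff rel_avoiding_0_iff)
qed

section \<open>Counting left-to-right maxima with a running threshold\<close>

lemma records_above_eq_card: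
  "records_above m xs = card {j. j < length xs \<and> m < xs ! j \<and> (\<forall>i<j. xs ! i < xs ! j)}"
proof (induction xs arbitrary: m)
  case (Cons x xs)
  \<comment> \<open>An entry of the tail is a record of the whole list above \<open>m\<close> iff it
    is a record of the tail that also exceeds \<open>x\<close>; the threshold therefore becomes max
    m x.\<close>
  let ?S = "{j. j < length xs \<and> max m x < xs ! j \<and> (\<forall>i<j. xs ! i < xs ! j)}"
  have "j \<in> {j. j < length (x # xs) \<and> m < (x # xs) ! j \<and> (\<forall>i<j. (x # xs) ! i < (x # xs) ! j)}
      \<longleftrightarrow> j \<in> (if m < x then {0} else {}) \<union> Suc ` ?S" for j
    by (cases j) (auto simp: All_less_Suc2)
  then have eq: "{j. j < length (x # xs) \<and> m < (x # xs) ! j \<and> (\<forall>i<j. (x # xs) ! i < (x # xs) ! j)}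
      = (if m < x then {0} else {}) \<union> Suc ` ?S" by blast
  have "card (Suc ` ?S) = records_above (max m x) xs"
    unfolding Cons.IH by (rule card_image) simp
  then show ?case unfolding eq by (auto simp: card_insert_if max_def)
qed simp

lemma num_ltr_max_eq_records_above:
  assumes "0 \<notin> set xs"
  shows "num_ltr_max xs = records_above 0 xs"
proof -
  \<comment> \<open>\<open>Suc\<close> passes from list indices to 1-based positions; entries being
    positive makes the threshold 0 vacuous.\<close>
  have "bij_betw Suc {j. j < length xs \<and> 0 < xs ! j \<and> (\<forall>i<j. xs ! i < xs ! j)} (ltr_max_positions xs)"
    unfolding bij_betw_def
  proof (intro conjI set_eqI iffI)
    fix j assume "j \<in> ltr_max_positions xs"
    then have j: "1 \<le> j" "j \<le> length xs" "\<forall>i\<in>{1..<j}. xs ! (i - 1) < xs ! (j - 1)"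
      by (auto simp: ltr_max_positions_def)
    have "xs ! i < xs ! (j - 1)" if "i < j - 1" for i using j(3)[rule_format, of "Suc i"] that by auto
    moreover have "xs ! (j - 1) \<in> set xs" using j by auto
    then have "0 < xs ! (j - 1)" using assms by (metis gr0I)
    ultimately have "j - 1 \<in> {j. j < length xs \<and> 0 < xs ! j \<and> (\<forall>i<j. xs ! i < xs ! j)}" using j by auto
    then show "j \<in> Suc ` {j. j < length xs \<and> 0 < xs ! j \<and> (\<forall>i<j. xs ! i < xs ! j)}"
      using j(1) by (intro image_eqI[of _ _ "j - 1"]) auto
  qed (auto simp: ltr_max_positions_def)
  from bij_betw_same_card[OF this] show ?thesis
    by (simp only: num_ltr_max_def records_above_eq_card)
qed

subsection \<open>Counting by lattice paths\<close>

text \<open>A 2 by 2 determinant of binomial coefficients, the shape of a count of pairs of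
  non-crossing lattice paths. The cases s = 0 and k = 0 are separate because truncated s - 1 and k -
  1 would falsify them: the formula would give r at s = k = 1 - 1 + k with k = 1 and s = 0, and 0 at
  s = k = 0.\<close>

definition completions :: "nat \<Rightarrow> nat \<Rightarrow> nat \<Rightarrow> real" where
  "completions r s k = (case k of 0 \<Rightarrow> of_bool (s = 0)
     | Suc l \<Rightarrow> (case s of 0 \<Rightarrow> 0
        | Suc t \<Rightarrow> real (t choose l) * real ((r + s) choose k) - real (t choose k) * real ((r + s) choose l)))"

text \<open>The continuations whose first entry is a new maximum; for \<open>r > 0\<close> this is
  \<open>completions r s k - completions (r - 1) s k\<close>.\<close>

definition completions_record_first :: "nat \<Rightarrow> nat \<Rightarrow> nat \<Rightarrow> real" where
  "completions_record_first r s k = (case k of 0 \<Rightarrow> 0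
     | Suc l \<Rightarrow> (case s of 0 \<Rightarrow> 0
        | Suc t \<Rightarrow> real (t choose l) * real ((r + t) choose l) -
            real (t choose k) * (case l of 0 \<Rightarrow> 0 | Suc i \<Rightarrow> real ((r + t) choose i))))"

lemma completions_0_left: "completions 0 s (Suc k) = completions_record_first 0 s (Suc k)"
  by (auto simp: completions_def completions_record_first_def algebra_simps split: nat.splits)

lemma completions_Suc_left:
  "completions (Suc r) s (Suc k) = completions r s (Suc k) + completions_record_first (Suc r) s (Suc k)"
  by (auto simp: completions_def completions_record_first_def algebra_simps split: nat.splits)

text \<open>Let b be the smallest of the s + 1 values above the maximum. If b is the next maximum, r
  values remain below and s above. Otherwise b ends up below the next maximum, so it may be counted
  among the lower values from the outset.\<close>

lemma completions_record_first_Suc: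
  "completions_record_first r (Suc s) (Suc k) =
     completions r s k + completions_record_first (Suc r) s (Suc k)"
  by (auto simp: completions_def completions_record_first_def algebra_simps split: nat.splits)

lemma sum_completions:
  assumes "finite (A :: nat set)"
  shows "(\<Sum>x\<in>A. completions (r + card {v \<in> A. v < x}) (card {v \<in> A. x < v}) k)
    = completions_record_first r (card A) (Suc k)"
  using assms
proof (induction A arbitrary: r rule: finite_linorder_min_induct)
  case empty
  show ?case by (simp add: completions_record_first_def)
next
  case (insert b A)
  have b: "b \<notin> A" using insert.hyps by auto
  have first: "{v \<in> insert b A. v < b} = {}" "{v \<in> insert b A. b < v} = A"
    using insert.hyps by auto
  have "{v \<in> insert b A. v < x} = insert b {v \<in> A. v < x}" "{v \<in> insert b A. x < v} = {v \<in> A. x < v}"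
    if "x \<in> A" for x using insert.hyps that by auto
  then have "(\<Sum>x\<in>A. completions (r + card {v \<in> insert b A. v < x}) (card {v \<in> insert b A. x < v}) k)
      = (\<Sum>x\<in>A. completions (Suc r + card {v \<in> A. v < x}) (card {v \<in> A. x < v}) k)"
    using b insert.hyps(1) by (intro sum.cong) auto
  also have "\<dots> = completions_record_first (Suc r) (card A) (Suc k)" by (rule insert.IH)
  finally show ?case
    using b insert.hyps(1)
    by (simp only: sum.insert first completions_record_first_Suc card.insert card.empty
        add_0_right not_False_eq_True)
qed

text \<open>Classification by the first entry: below the maximum a single value is admissible, and
  using it lowers r by one; any other first entry is a new maximum.\<close>

lemma completions_recurrence:
  assumes "r + s \<noteq> 0"
  shows "completions r s k =
    (if r = 0 then 0 else completions (r - 1) s k) + completions_record_first r s k"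
proof (cases k)
  case 0
  then show ?thesis using assms
    by (auto simp: completions_def completions_record_first_def)
next
  case (Suc l)
  then show ?thesis
    by (cases r) (simp_all add: completions_0_left completions_Suc_left)
qed

text \<open>The value set \<open>V\<close> is arbitrary because the values left after some entries
  need not form an interval.\<close>

definition avoiding_perms :: "(nat \<Rightarrow> nat \<Rightarrow> bool) \<Rightarrow> nat \<Rightarrow> nat \<Rightarrow> nat set \<Rightarrow> nat list set" where
  "avoiding_perms R m k V =
     {xs \<in> permutations_of_set V. rel_avoiding R m xs \<and> records_above m xs = k}"

lemma finite_avoiding_perms [simp]: "finite (avoiding_perms R m k V)"
  by (simp add: avoiding_perms_def)

lemma avoiding_perms_nonempty:
  assumes "V \<noteq> {}" "m \<notin> V"
  shows "avoiding_perms R m k V =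
    (\<Union>x\<in>V. (#) x ` (if m < x then if k = 0 then {} else avoiding_perms R x (k - 1) (V - {x})
       else if \<forall>y\<in>V - {x}. y < m \<longrightarrow> R x y then avoiding_perms R m k (V - {x}) else {}))"
    (is "_ = (\<Union>x\<in>V. (#) x ` ?W x)")
proof (rule set_eqI)
  fix ys
  show "ys \<in> avoiding_perms R m k V \<longleftrightarrow> ys \<in> (\<Union>x\<in>V. (#) x ` ?W x)"
  proof (cases ys)
    case Nil
    then show ?thesis using assms by (auto simp: avoiding_perms_def permutations_of_set_nonempty)
  next
    case (Cons x xs)
    \<comment> \<open>This discharges the guard x < m in \<open>rel_avoiding\<close>: as
      \<open>m\<close> is not in \<open>V\<close>, a first entry that is no record lies strictly
      below \<open>m\<close>.\<close>
    have "x < m" if "x \<in> V" "\<not> m < x" using that assms(2) by (metis linorder_neqE_nat)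
    then have "x # xs \<in> avoiding_perms R m k V \<longleftrightarrow> x \<in> V \<and> xs \<in> ?W x"
      using assms(1)
      by (cases k) (auto simp: avoiding_perms_def permutations_of_set_nonempty
          dest: permutations_of_setD split: if_splits)
    moreover have "x # xs \<in> (\<Union>z\<in>V. (#) z ` W z) \<longleftrightarrow> x \<in> V \<and> xs \<in> W x" for W
      by auto
    ultimately show ?thesis unfolding Cons by (simp only:)
  qed
qed

text \<open>The hypothesis on \<open>R\<close> gives each nonempty finite set exactly one element
  that may precede all the others (the minimum for \<open><\<close>, the maximum for
  \<open>>\<close>). So one value below \<open>m\<close> can come next, and the count is the same
  for both patterns.\<close>

lemma card_avoiding_perms:
  assumes R: "\<And>B :: nat set. finite B \<Longrightarrow> B \<noteq> {} \<Longrightarrow> \<exists>x\<in>B. \<forall>y\<in>B - {x}. R x y \<and> \<not> R y x"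
    and "finite V" "m \<notin> V"
  shows "real (card (avoiding_perms R m k V)) = completions (card {v \<in> V. v < m}) (card {v \<in> V. m < v}) k"
  using assms(2,3)
proof (induction V arbitrary: m k rule: finite_psubset_induct)
  case (psubset V)
  note fin = \<open>finite V\<close> and m = \<open>m \<notin> V\<close>
  have IH: "real (card (avoiding_perms R n l (V - {x})))
      = completions (card {v \<in> V - {x}. v < n}) (card {v \<in> V - {x}. n < v}) l"
    if "x \<in> V" "n \<notin> V - {x}" for x n l
    using psubset.IH[of "V - {x}" n l] that by blast
  show ?case
  proof (cases "V = {}")
    case True
    then have "avoiding_perms R m k V = (if k = 0 then {[]} else {})"
      by (auto simp: avoiding_perms_def)
    then show ?thesis using True by (cases k) (simp_all add: completions_def)
  next
    case False
    \<comment> \<open>\<open>W x\<close> collects the possible tails after the first entry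
      \<open>x\<close>.\<close>
    define W where "W x = (if m < x then if k = 0 then {} else avoiding_perms R x (k - 1) (V - {x})
       else if \<forall>y\<in>V - {x}. y < m \<longrightarrow> R x y then avoiding_perms R m k (V - {x}) else {})" for x
    define L where "L = {v \<in> V. v < m}"
    define U where "U = {v \<in> V. m < v}"
    have V: "V = L \<union> U" "L \<inter> U = {}" and fin': "finite L" "finite U"
      using m fin by (auto simp: L_def U_def) (metis linorder_neqE_nat)
    have "avoiding_perms R m k V = (\<Union>x\<in>V. (#) x ` W x)"
      using avoiding_perms_nonempty[OF False m] by (simp add: W_def)
    also have "card \<dots> = (\<Sum>x\<in>V. card ((#) x ` W x))"
      using fin by (intro card_UN_disjoint) (auto simp: W_def)
    also have "\<dots> = (\<Sum>x\<in>V. card (W x))"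
      by (intro sum.cong refl card_image) auto
    also have "\<dots> = (\<Sum>x\<in>L. card (W x)) + (\<Sum>x\<in>U. card (W x))"
      unfolding V(1) by (rule sum.union_disjoint) (use fin' V in auto)
    finally have card: "real (card (avoiding_perms R m k V)) =
        (\<Sum>x\<in>L. real (card (W x))) + (\<Sum>x\<in>U. real (card (W x)))"
      by simp
    have below: "(\<Sum>x\<in>L. real (card (W x))) =
        (if card L = 0 then 0 else completions (card L - 1) (card U) k)"
    proof (cases "L = {}")
      case False
      then obtain z where z: "z \<in> L" "\<forall>y\<in>L - {z}. R z y \<and> \<not> R y z"
        using R fin' by blast
      have zV: "z \<in> V" "\<not> m < z" using z by (auto simp: L_def)
      have sets: "{v \<in> V - {z}. v < m} = L - {z}" "{v \<in> V - {z}. m < v} = U"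
        using zV by (auto simp: L_def U_def)
      \<comment> \<open>Starting with such an \<open>x\<close> would leave \<open>z\<close> for
        later, still below \<open>m\<close>, although \<open>R x z\<close> fails.\<close>
      have "W x = {}" if "x \<in> L - {z}" for x
      proof -
        have "z \<in> V - {x}" "z < m" "\<not> R x z" "\<not> m < x" using that z by (auto simp: L_def)
        then show ?thesis unfolding W_def by auto
      qed
      then have "(\<Sum>x\<in>L. real (card (W x))) = real (card (W z))"
        using fin' z by (simp add: sum.remove[of L z])
      also have "\<forall>y\<in>V - {z}. y < m \<longrightarrow> R z y" using z by (auto simp: L_def)
      then have "W z = avoiding_perms R m k (V - {z})" using zV by (simp add: W_def)
      also have "real (card \<dots>) = completions (card L - 1) (card U) k"
        using IH[OF zV(1), of m k] m z(1) fin' unfolding sets by simp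
      finally show ?thesis using False fin' by simp
    qed simp
    have above: "(\<Sum>x\<in>U. real (card (W x))) = completions_record_first (card L) (card U) k"
    proof (cases k)
      case 0
      then have "W x = {}" if "x \<in> U" for x using that by (simp add: W_def U_def)
      then show ?thesis using 0 by (simp add: completions_record_first_def)
    next
      case (Suc l)
      have "real (card (W x)) =
          completions (card L + card {v \<in> U. v < x}) (card {v \<in> U. x < v}) l" if "x \<in> U" for x
      proof -
        have x: "x \<in> V" "m < x" using that by (auto simp: U_def)
        have "{v \<in> V - {x}. v < x} = L \<union> {v \<in> U. v < x}"
          using V(1) x by (auto simp: L_def)
        then have "card {v \<in> V - {x}. v < x} = card L + card {v \<in> U. v < x}"
          using fin' V(2) by (simp add: card_Un_disjoint disjoint_iff)
        moreover have "{v \<in> V - {x}. x < v} = {v \<in> U. x < v}"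
          using x by (auto simp: U_def)
        ultimately show ?thesis
          using IH[OF x(1), of x l] x Suc by (simp add: W_def)
      qed
      then show ?thesis using sum_completions[OF fin'(2)] Suc by simp
    qed
    have "card L + card U \<noteq> 0" using False V fin' by auto
    from completions_recurrence[OF this, of k] show ?thesis
      unfolding card below above by (simp only: L_def[symmetric] U_def[symmetric])
  qed
qed

section \<open>Narayana and Catalan identities\<close>

lemma Suc_times_choose_Suc:
  assumes "l \<le> n"
  shows "real (Suc l) * real (n choose Suc l) = (real n - real l) * real (n choose l)"
proof -
  have "Suc l * (n choose Suc l) = (n - l) * (n choose l)"
    by (simp only: binomial_absorption binomial_absorb_comp)
  then have "real (Suc l) * real (n choose Suc l) = real (n - l) * real (n choose l)"
    by (metis of_nat_mult)
  then show ?thesis using assms by (simp add: of_nat_diff)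
qed

text \<open>With k = l + 1 and N = t + 1, multiplying by k and absorbing it into both products
  leaves C(t,l) C(N,l) times (N - l) - (t - l) = 1.\<close>

lemma completions_eq_narayana:
  assumes "k \<in> {1..N}"
  shows "completions 0 N k = narayana N k"
proof -
  obtain l t where lt: "k = Suc l" "N = Suc t" "l \<le> t"
    using assms by (cases k; cases N) auto
  have lN: "l \<le> N" using lt by simp
  have "real (Suc l) * completions 0 N k =
      real (t choose l) * (real (Suc l) * real (N choose Suc l)) -
      (real (Suc l) * real (t choose Suc l)) * real (N choose l)"
    using lt(1,2) by (simp only: completions_def nat.case add_0 right_diff_distrib ac_simps)
  also have "\<dots> = real (t choose l) * real (N choose l)"
    unfolding Suc_times_choose_Suc[OF lt(3)] Suc_times_choose_Suc[OF lN]
    using lt(2) by (simp add: algebra_simps del: binomial_Suc_Suc)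
  finally show ?thesis
    using lt(1,2) by (simp add: narayana_def field_simps del: binomial_Suc_Suc)
qed

text \<open>In this form the symmetry is visible: replacing k by N + 1 - k swaps the two binomial
  coefficients.\<close>

lemma narayana_symmetric_form:
  assumes "k \<in> {1..N}"
  shows "narayana N k = real (N choose k) * real (N choose (k - 1)) / real N"
proof -
  obtain l t where lt: "k = Suc l" "N = Suc t"
    using assms by (cases k; cases N) auto
  have "real (Suc l) * real (N choose Suc l) = real N * real (t choose l)"
    using binomial_absorption[of l N] lt(2) by (metis of_nat_mult diff_Suc_1)
  then have "real (N choose Suc l) / real N = real (t choose l) / real (Suc l)"
    using lt(2) by (simp only: divide_eq_eq eq_divide_eq) (simp add: mult.commute del: binomial_Suc_Suc)
  then show ?thesis
    using lt by (simp add: narayana_def del: binomial_Suc_Suc) (metis times_divide_eq_left)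
qed

lemma narayana_reflect:
  assumes "k \<in> {1..N}"
  shows "narayana N (N + 1 - k) = narayana N k"
proof -
  have "N choose (N + 1 - k) = N choose (k - 1)" "N choose (N + 1 - k - 1) = N choose k"
    using assms binomial_symmetric[of "k - 1" N] binomial_symmetric[of k N] by (auto simp: Suc_diff_le)
  moreover have "N + 1 - k \<in> {1..N}" using assms by auto
  ultimately show ?thesis using assms by (simp add: narayana_symmetric_form)
qed

text \<open>For the weighted sum S and the plain sum T, reflecting the index gives S = (N + 1) T -
  S.\<close>

lemma sum_narayana_weighted:
  "(\<Sum>k\<in>{1..N}. real k * narayana N k) = (real N + 1) / 2 * (\<Sum>k\<in>{1..N}. narayana N k)"
proof -
  have "(\<Sum>k\<in>{1..N}. real k * narayana N k) = (\<Sum>k\<in>{1..N}. real (N + 1 - k) * narayana N (N + 1 - k))"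
    by (rule sum.reindex_bij_witness[of _ "\<lambda>k. N + 1 - k" "\<lambda>k. N + 1 - k"]) auto
  also have "\<dots> = (\<Sum>k\<in>{1..N}. (real N + 1) * narayana N k - real k * narayana N k)"
    by (intro sum.cong refl, subst narayana_reflect) (auto simp: of_nat_diff algebra_simps)
  also have "\<dots> = (real N + 1) * (\<Sum>k\<in>{1..N}. narayana N k) - (\<Sum>k\<in>{1..N}. real k * narayana N k)"
    by (simp add: sum_subtractf sum_distrib_left)
  finally show ?thesis by simp
qed

lemma catalan_ratio:
  assumes "N \<ge> 1"
  shows "(2 * real N - 1) * catalan (N - 1) / catalan N = (real N + 1) / 2"
proof -
  obtain t where N: "N = Suc t" using assms by (cases N) auto
  \<comment> \<open>The recurrence of the central binomial coefficients, by two absorption steps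
    through C(2t+1, t).\<close>
  have "real (Suc t) * real (2 * Suc t choose Suc t) = 2 * (2 * real t + 1) * real (2 * t choose t)"
  proof -
    have "Suc t * (2 * Suc t choose Suc t) = 2 * (Suc t * (Suc (2 * t) choose t))"
      using binomial_absorption[of t "2 * Suc t"] by (simp del: binomial_Suc_Suc)
    also have "Suc t * (Suc (2 * t) choose t) = Suc (2 * t) * (2 * t choose t)"
      using binomial_absorb_comp[of "Suc (2 * t)" t] by (simp add: Suc_diff_le del: binomial_Suc_Suc)
    finally have "real (Suc t * (2 * Suc t choose Suc t)) = real (2 * (Suc (2 * t) * (2 * t choose t)))"
      by (simp only:)
    then show ?thesis by (simp only: of_nat_mult of_nat_Suc) simp
  qed
  then have "real (2 * Suc t choose Suc t) = 2 * (2 * real t + 1) * real (2 * t choose t) / (real t + 1)"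
    by (simp only: eq_divide_eq of_nat_Suc) (simp add: ac_simps del: binomial_Suc_Suc)
  moreover have "real (2 * t choose t) \<noteq> 0" by simp
  \<comment> \<open>The remaining fraction identity, with a for t and y for C(2t, t), so that only
    field arithmetic is left.\<close>
  moreover have "(2 * (a + 1) - 1) * (1 / (a + 1) * y) /
      (1 / (a + 1 + 1) * (2 * (2 * a + 1) * y / (a + 1))) = (a + 1 + 1) / 2"
    if "y \<noteq> 0" "a \<ge> 0" for a y :: real
  proof -
    have "2 * a + 1 \<noteq> 0" "a + 1 \<noteq> 0" "a + 2 \<noteq> 0" using that by auto
    then show ?thesis using that by (simp add: divide_simps)
  qed
  ultimately show ?thesis unfolding catalan_def N
    by (simp only: diff_Suc_1 of_nat_Suc add.commute[of 1] of_nat_0_le_iff not_False_eq_True)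
qed

section \<open>Distribution and mean of left-to-right maxima on avoiders\<close>

lemma card_avoiders_num_ltr_max:
  assumes "\<rho> \<in> {[3,2,1], [3,1,2]}" "k \<in> {1..N}"
  shows "real (card {\<pi> \<in> avoiders \<rho> N. num_ltr_max \<pi> = k}) = narayana N k"
proof -
  have *: "real (card {\<pi> \<in> avoiders \<rho> N. num_ltr_max \<pi> = k}) = narayana N k"
    if R: "\<And>B :: nat set. finite B \<Longrightarrow> B \<noteq> {} \<Longrightarrow> \<exists>x\<in>B. \<forall>y\<in>B - {x}. R x y \<and> \<not> R y x"
      and avoids: "\<And>xs. distinct xs \<Longrightarrow> avoids xs \<rho> \<longleftrightarrow> rel_avoiding R 0 xs" for R
  proof -
    have "num_ltr_max xs = records_above 0 xs \<and> distinct xs" if "xs \<in> perms N" for xs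
      using permutations_of_setD[OF that] by (intro conjI num_ltr_max_eq_records_above) auto
    then have "{\<pi> \<in> avoiders \<rho> N. num_ltr_max \<pi> = k} = avoiding_perms R 0 k {1..N}"
      unfolding avoiders_def avoiding_perms_def using avoids by auto
    \<comment> \<open>Initially the running maximum is 0, hence r = 0 and s = N.\<close>
    moreover have "{v \<in> {1..N}. v < 0} = {}" "{v \<in> {1..N}. 0 < v} = {1..N}" by auto
    ultimately show ?thesis
      using card_avoiding_perms[OF R, of "{1..N}" 0 k] completions_eq_narayana[OF assms(2)] by simp
  qed
  have min: "\<exists>x\<in>B. \<forall>y\<in>B - {x}. x < y \<and> \<not> y < x" if "finite B" "B \<noteq> {}" for B :: "nat set"
  proof (intro bexI ballI)
    fix y assume "y \<in> B - {Min B}"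
    then show "Min B < y \<and> \<not> y < Min B" using Min_le[OF that(1), of y] by simp
  qed (use that in simp)
  have max: "\<exists>x\<in>B. \<forall>y\<in>B - {x}. y < x \<and> \<not> x < y" if "finite B" "B \<noteq> {}" for B :: "nat set"
  proof (intro bexI ballI)
    fix y assume "y \<in> B - {Max B}"
    then show "y < Max B \<and> \<not> Max B < y" using Max_ge[OF that(1), of y] by simp
  qed (use that in simp)
  from assms(1) consider "\<rho> = [3,2,1]" | "\<rho> = [3,1,2]" by blast
  then show ?thesis
  proof cases
    case 1
    show ?thesis by (rule *[OF min]) (simp_all only: 1 avoids_321_iff not_False_eq_True)
  next
    case 2
    show ?thesis by (rule *[OF max]) (simp_all only: 2 avoids_312_iff not_False_eq_True)
  qed
qed

lemma ltr_max_positions_subset: "ltr_max_positions xs \<subseteq> {1..length xs}"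
  by (auto simp: ltr_max_positions_def)

lemma num_ltr_max_bounds:
  assumes "xs \<noteq> []"
  shows "num_ltr_max xs \<in> {1..length xs}"
proof -
  have "1 \<in> ltr_max_positions xs" using assms by (auto simp: ltr_max_positions_def Suc_le_eq)
  moreover have "finite (ltr_max_positions xs)"
    using ltr_max_positions_subset finite_subset by blast
  ultimately have "num_ltr_max xs \<noteq> 0" by (auto simp: num_ltr_max_def)
  moreover have "num_ltr_max xs \<le> length xs"
    using card_mono[OF _ ltr_max_positions_subset, of xs] by (simp add: num_ltr_max_def)
  ultimately show ?thesis by simp
qed

lemma finite_avoiders [simp]: "finite (avoiders \<rho> N)"
  by (simp add: avoiders_def)

lemma perms_length: "xs \<in> perms N \<Longrightarrow> length xs = N"
  using length_finite_permutations_of_set[of xs "{1..N}"] by simp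

lemma
  assumes "\<rho> \<in> {[3,2,1], [3,1,2]}" "N \<ge> 1"
  shows avoiders_nonempty: "avoiders \<rho> N \<noteq> {}"
    and sum_num_ltr_max_avoiders:
      "(\<Sum>\<pi>\<in>avoiders \<rho> N. real (num_ltr_max \<pi>)) = (real N + 1) / 2 * real (card (avoiders \<rho> N))"
proof -
  \<comment> \<open>Nonemptiness comes from k = 1: exactly one avoider has a single left-to-right
    maximum.\<close>
  have "narayana N 1 = 1" by (simp add: narayana_def)
  then have "card {\<pi> \<in> avoiders \<rho> N. num_ltr_max \<pi> = 1} = 1"
    using card_avoiders_num_ltr_max[OF assms(1), of 1 N] assms(2) by simp
  then show "avoiders \<rho> N \<noteq> {}" by auto
  have range: "num_ltr_max ` avoiders \<rho> N \<subseteq> {1..N}"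
  proof (rule image_subsetI)
    fix \<pi> assume "\<pi> \<in> avoiders \<rho> N"
    then have "length \<pi> = N" by (auto simp: avoiders_def intro: perms_length)
    then show "num_ltr_max \<pi> \<in> {1..N}" using num_ltr_max_bounds[of \<pi>] assms(2) by force
  qed
  \<comment> \<open>Grouping by the number of maxima for a general \<open>f\<close>: the identity
    yields the total of maxima, the constant 1 the number of avoiders.\<close>
  have sum: "(\<Sum>\<pi>\<in>avoiders \<rho> N. f (num_ltr_max \<pi>)) = (\<Sum>k\<in>{1..N}. f k * narayana N k)" for f :: "nat \<Rightarrow> real"
  proof -
    have "(\<Sum>\<pi>\<in>avoiders \<rho> N. f (num_ltr_max \<pi>)) =
        (\<Sum>k\<in>{1..N}. \<Sum>\<pi>\<in>{\<pi> \<in> avoiders \<rho> N. num_ltr_max \<pi> = k}. f (num_ltr_max \<pi>))"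
      by (rule sum.group[symmetric]) (use range in auto)
    also have "\<dots> = (\<Sum>k\<in>{1..N}. f k * narayana N k)"
      by (intro sum.cong refl) (simp add: card_avoiders_num_ltr_max[OF assms(1)] mult.commute)
    finally show ?thesis .
  qed
  show "(\<Sum>\<pi>\<in>avoiders \<rho> N. real (num_ltr_max \<pi>)) = (real N + 1) / 2 * real (card (avoiders \<rho> N))"
    using sum[of real] sum[of "\<lambda>_. 1"] sum_narayana_weighted[of N] by simp
qed

lemma expectation_num_ltr_max_avoiders:
  assumes "\<rho> \<in> {[3,2,1], [3,1,2]}" "N \<ge> 1"
  shows "measure_pmf.expectation (pmf_of_set (avoiders \<rho> N)) (\<lambda>\<pi>. real (num_ltr_max \<pi>)) = (real N + 1) / 2"
  using avoiders_nonempty[OF assms] sum_num_ltr_max_avoiders[OF assms]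
  by (simp add: integral_pmf_of_set)

subsection \<open>The game\<close>

lemma card_le_less_iff:
  fixes xs :: "nat list"
  assumes "x \<in> set xs" "y \<in> set xs"
  shows "card {z \<in> set xs. z \<le> x} < card {z \<in> set xs. z \<le> y} \<longleftrightarrow> x < y"
proof -
  have mono: "card {z \<in> set xs. z \<le> a} < card {z \<in> set xs. z \<le> b}" if "a < b" "b \<in> set xs" for a b
  proof (rule psubset_card_mono)
    have "b \<in> {z \<in> set xs. z \<le> b}" "b \<notin> {z \<in> set xs. z \<le> a}" using that by auto
    moreover have "{z \<in> set xs. z \<le> a} \<subseteq> {z \<in> set xs. z \<le> b}" using that by force
    ultimately show "{z \<in> set xs. z \<le> a} \<subset> {z \<in> set xs. z \<le> b}" by blast
  qed simp
  show ?thesis using mono[of x y] mono[of y x] assms by (cases x y rule: linorder_cases) auto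
qed

lemma length_flatten [simp]: "length (flatten xs) = length xs"
  by (simp add: flatten_def)

lemma length_prefix_pattern: "length (prefix_pattern i xs) = min i (length xs)"
  by (simp add: prefix_pattern_def)

lemma flatten_nth_less_iff:
  assumes "i < length xs" "j < length xs"
  shows "flatten xs ! i < flatten xs ! j \<longleftrightarrow> xs ! i < xs ! j"
  using assms by (simp add: flatten_def card_le_less_iff)

lemma flatten_map:
  assumes "\<And>x y. x \<in> set xs \<Longrightarrow> y \<in> set xs \<Longrightarrow> f x < f y \<longleftrightarrow> x < y"
  shows "flatten (map f xs) = flatten xs"
  unfolding flatten_def map_map
proof (rule map_cong[OF refl])
  fix x assume x: "x \<in> set xs"
  have le: "f y \<le> f x \<longleftrightarrow> y \<le> x" if "y \<in> set xs" for y
    using assms[OF x that] by (simp only: linorder_not_less[symmetric])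
  have inj: "inj_on f (set xs)"
  proof (rule inj_onI)
    fix y z assume "y \<in> set xs" "z \<in> set xs" "f y = f z"
    then show "y = z" using assms[of y z] assms[of z y] by (cases y z rule: linorder_cases) auto
  qed
  have "{y \<in> set (map f xs). y \<le> f x} = f ` {y \<in> set xs. y \<le> x}" using le by auto
  then show "((\<lambda>x. card {y \<in> set (map f xs). y \<le> x}) \<circ> f) x = card {y \<in> set xs. y \<le> x}"
    using inj by (simp add: card_image inj_on_subset)
qed

text \<open>Ranking within \<open>xs\<close> is strictly increasing on its entries, so it does not
  change the relative order of the first \<open>j\<close> of them.\<close>

lemma flatten_take_flatten: "flatten (take j (flatten xs)) = flatten (take j xs)"
  unfolding flatten_def[of xs] take_map
  by (rule flatten_map, rule card_le_less_iff) (auto dest: in_set_takeD)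

lemma prefix_pattern_prefix_pattern:
  assumes "j \<le> i"
  shows "prefix_pattern j (prefix_pattern i xs) = prefix_pattern j xs"
  using assms by (simp add: prefix_pattern_def flatten_take_flatten min_absorb1)

lemma contains_prefix_pattern:
  assumes "j \<le> i" "i \<le> length xs"
  shows "contains (prefix_pattern i xs) (prefix_pattern j xs)"
  using assms by (simp add: contains_def length_prefix_pattern prefix_pattern_prefix_pattern min_absorb2)

lemma flatten_perm:
  assumes "xs \<in> perms n"
  shows "flatten xs = xs"
proof -
  have "set xs = {1..n}" using permutations_of_setD[OF assms] by simp
  moreover have "card {y \<in> {1..n}. y \<le> x} = x" if "x \<in> {1..n}" for x
  proof -
    have "{y \<in> {1..n}. y \<le> x} = {1..x}" using that by auto
    then show ?thesis by simp
  qed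
  ultimately show ?thesis unfolding flatten_def by (intro map_idI) simp
qed

lemma prefix_pattern_length_perm:
  assumes "xs \<in> perms n"
  shows "prefix_pattern n xs = xs"
  using assms by (simp add: prefix_pattern_def perms_length flatten_perm)

lemma last_ltr_max_prefix_pattern:
  assumes "i \<in> {1..length xs}" "i \<in> ltr_max_positions (prefix_pattern i xs)"
  shows "i \<in> ltr_max_positions xs"
proof -
  have "xs ! (j - 1) < xs ! (i - 1)" if "j \<in> {1..<i}" for j
  proof -
    have "prefix_pattern i xs ! (j - 1) < prefix_pattern i xs ! (i - 1)"
      using assms(2) that by (auto simp: ltr_max_positions_def)
    then show ?thesis
      using assms(1) that flatten_nth_less_iff[of "j - 1" "take i xs" "i - 1"]
      by (auto simp: prefix_pattern_def min_absorb2)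
  qed
  then show ?thesis using assms(1) by (auto simp: ltr_max_positions_def)
qed

section \<open>Maximal antichains and winning\<close>

lemma maximal_antichain_prefix_unique:
  assumes A: "maximal_antichain n A" and "j \<in> {1..n}" "i \<in> {1..n}" "length xs = n"
    and "prefix_pattern i xs \<in> A" "prefix_pattern j xs \<in> A"
  shows "j = i"
proof (rule ccontr)
  assume "j \<noteq> i"
  \<comment> \<open>The prefix patterns of one list form a chain, and their lengths tell them apart;
    an antichain contains at most one of them.\<close>
  moreover have "comparable (prefix_pattern i xs) (prefix_pattern j xs)"
    using assms contains_prefix_pattern[of i j xs] contains_prefix_pattern[of j i xs]
    by (cases "i \<le> j") (auto simp: comparable_def)
  moreover have "length (prefix_pattern i xs) = i" "length (prefix_pattern j xs) = j"
    using assms by (auto simp: length_prefix_pattern)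
  ultimately have "prefix_pattern i xs \<noteq> prefix_pattern j xs" by auto
  then show False
    using A assms(5,6) \<open>comparable (prefix_pattern i xs) (prefix_pattern j xs)\<close>
    by (simp add: maximal_antichain_def)
qed

text \<open>Since \<open>n\<close> is a left-to-right maximum position, the whole permutation is a
  node of the tree, and of maximal size. A member of \<open>A\<close> comparable to it must be one
  of its prefixes, which gives existence; uniqueness is the chain argument.\<close>

lemma maximal_antichain_meets:
  assumes A: "maximal_antichain n A" and n: "n \<ge> 1" and "\<pi> \<in> perms n" "n \<in> ltr_max_positions \<pi>"
  shows "card {i \<in> ltr_max_positions \<pi>. prefix_pattern i \<pi> \<in> A} = 1"
proof -
  have len: "length \<pi> = n" using assms by (simp add: perms_length)
  have "\<pi> \<in> prefix_tree n" using assms len by (auto simp: prefix_tree_def)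
  then obtain q where q: "q \<in> A" "comparable \<pi> q" using A unfolding maximal_antichain_def by blast
  then have "q \<in> prefix_tree n" using A by (auto simp: maximal_antichain_def)
  then obtain i where i: "i \<in> {1..n}" "q \<in> perms i" "length q \<in> ltr_max_positions q"
    by (auto simp: prefix_tree_def)
  then have lq: "length q = i" by (simp add: perms_length)
  have "prefix_pattern i \<pi> = q"
    using q(2) unfolding comparable_def
  proof
    \<comment> \<open>A node containing a permutation of the full size \<open>n\<close> coincides
      with it.\<close>
    assume "contains q \<pi>"
    then have "n = i" "prefix_pattern n q = \<pi>" using i(1) by (auto simp: contains_def len lq)
    then show ?thesis
      using prefix_pattern_length_perm[OF i(2)] prefix_pattern_length_perm[OF assms(3)] by simp
  qed (simp add: contains_def lq)
  then have "i \<in> ltr_max_positions \<pi>"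
    using i(1,3) lq len last_ltr_max_prefix_pattern[of i \<pi>] by simp
  then have "{j \<in> ltr_max_positions \<pi>. prefix_pattern j \<pi> \<in> A} = {i}"
  proof (intro equalityI subsetI)
    fix j assume "j \<in> {j \<in> ltr_max_positions \<pi>. prefix_pattern j \<pi> \<in> A}"
    moreover from this have "j \<in> {1..n}" using ltr_max_positions_subset[of \<pi>] len by auto
    ultimately show "j \<in> {i}"
      using maximal_antichain_prefix_unique[OF A _ i(1) len, of j] \<open>prefix_pattern i \<pi> = q\<close> q(1) by simp
  qed (use \<open>prefix_pattern i \<pi> = q\<close> q(1) in simp)
  then show ?thesis by simp
qed

text \<open>The value \<open>n\<close> occurs only at position \<open>i\<close>, so winning means
  stopping exactly there; an earlier stop would put two prefixes of one permutation into the
  antichain.\<close>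

lemma wins_iff_prefix_in_antichain:
  assumes A: "maximal_antichain n A" and "\<sigma> \<in> perms n" "i \<in> {1..n}" "\<sigma> ! (i - 1) = n"
  shows "wins n A \<sigma> \<longleftrightarrow> prefix_pattern i \<sigma> \<in> A"
proof
  assume "wins n A \<sigma>"
  then obtain j where j: "j \<in> {1..n}" "prefix_pattern j \<sigma> \<in> A" "\<sigma> ! (j - 1) = n"
    by (auto simp: wins_def)
  have "distinct \<sigma>" "length \<sigma> = n" using assms permutations_of_setD perms_length by auto
  then have "j - 1 = i - 1"
    using nth_eq_iff_index_eq[of \<sigma> "j - 1" "i - 1"] assms(3,4) j by auto
  then have "j = i" using j assms(3) by auto
  then show "prefix_pattern i \<sigma> \<in> A" using j by simp
next
  assume "prefix_pattern i \<sigma> \<in> A"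
  moreover have "prefix_pattern j \<sigma> \<notin> A" if "j \<in> {1..<i}" for j
    using maximal_antichain_prefix_unique[OF A, of j i \<sigma>] assms(3) perms_length[OF assms(2)] that
      \<open>prefix_pattern i \<sigma> \<in> A\<close>
    by auto
  ultimately show "wins n A \<sigma>"
    unfolding wins_def by (intro bexI[of _ i] conjI ballI) (use assms(3,4) in auto)
qed

lemma perms_1: "perms 1 = {[1]}" by simp

text \<open>Every node contains \<open>[1]\<close>. Having some maximal antichain makes the value
  described by \<open>THE\<close> in \<open>win_probability\<close> unique.\<close>

lemma maximal_antichain_singleton:
  assumes "n \<ge> 1"
  shows "maximal_antichain n {[1]}"
proof -
  have "[1] \<in> prefix_tree n"
    using assms perms_1 by (auto simp: prefix_tree_def ltr_max_positions_def intro!: bexI[of _ 1])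
  moreover have "comparable p [1]" if "p \<in> prefix_tree n" for p
  proof -
    have "p \<noteq> []" using that by (auto simp: prefix_tree_def ltr_max_positions_def)
    then obtain x xs where "p = x # xs" by (cases p) auto
    \<comment> \<open>The form in which the rank of the only entry appears once
      \<open>flatten [x]\<close> is unfolded.\<close>
    moreover have "{y. y = x \<and> y \<le> x} = {x}" by auto
    ultimately show ?thesis
      by (auto simp: comparable_def contains_def prefix_pattern_def flatten_def)
  qed
  ultimately show ?thesis by (simp add: maximal_antichain_def)
qed

section \<open>Win probability of a game with a bine of competitors\<close>

lemma measure_pmf_of_multiset:
  assumes "M \<noteq> {#}"
  shows "measure_pmf.prob (pmf_of_multiset M) {x. P x} = real (size (filter_mset P M)) / real (size M)"
proof -
  have "measure_pmf.prob (pmf_of_multiset M) {x. P x} =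
      measure_pmf.prob (pmf_of_multiset M) {x \<in> set_mset M. P x}"
    by (rule measure_eq_AE) (use assms in \<open>auto simp: AE_measure_pmf_iff\<close>)
  also have "\<dots> = (\<Sum>x\<in>{x \<in> set_mset M. P x}. real (count M x) / real (size M))"
    by (subst measure_measure_pmf_finite) (simp_all add: assms)
  also have "\<dots> = (\<Sum>x\<in>{x \<in> set_mset M. P x}. real (count M x)) / real (size M)"
    by (simp add: sum_divide_distrib)
  also have "(\<Sum>x\<in>{x \<in> set_mset M. P x}. real (count M x)) = real (size (filter_mset P M))"
    by (simp add: size_multiset_overloaded_eq)
  finally show ?thesis .
qed

text \<open>This moves the count of winning permutations to the pairs they were built from.\<close>

lemma rel_mset_size_filter:
  assumes "rel_mset R X Y" "\<And>x y. x \<in># X \<Longrightarrow> R x y \<Longrightarrow> P x \<longleftrightarrow> Q y"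
  shows "size (filter_mset P X) = size (filter_mset Q Y)"
  using assms by (induction rule: rel_mset_induct) auto

lemma rel_mset_memberD:
  assumes "rel_mset R X Y" "y \<in># Y"
  shows "\<exists>x. R x y"
  using assms by (induction rule: rel_mset_induct) auto

lemma size_filter_bine_pairs:
  "size (filter_mset P (bine_pairs n J)) =
     (\<Sum>\<pi>\<in>#J. card {i \<in> ltr_max_positions (\<pi> @ [n]). P (\<pi> @ [n], i)})"
proof (induction J)
  case (add \<pi> J)
  have "finite (ltr_max_positions (\<pi> @ [n]))" using ltr_max_positions_subset finite_subset by blast
  then show ?case using add by (simp add: bine_pairs_def filter_mset_image_mset)
qed (simp add: bine_pairs_def)

lemma bine_pairs_memberD:
  assumes "(\<pi>, i) \<in># bine_pairs n J"
  shows "\<exists>\<pi>'. \<pi>' \<in># J \<and> \<pi> = \<pi>' @ [n] \<and> i \<in> ltr_max_positions \<pi>"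
  using assms
proof (induction J)
  case (add \<pi>' J)
  have "finite (ltr_max_positions (\<pi>' @ [n]))" using ltr_max_positions_subset finite_subset by blast
  then show ?case using add by (auto simp: bine_pairs_def)
qed (simp add: bine_pairs_def)

lemma ltr_max_positions_snoc_max:
  assumes "\<And>x. x \<in> set xs \<Longrightarrow> x < m"
  shows "ltr_max_positions (xs @ [m]) = insert (Suc (length xs)) (ltr_max_positions xs)"
  using assms by (auto simp: ltr_max_positions_def nth_append le_Suc_eq)

lemma snoc_perm:
  assumes "\<pi> \<in> perms N"
  shows "\<pi> @ [N + 1] \<in> perms (N + 1)"
  using permutations_of_setD[OF assms] by (intro permutations_of_setI) auto

lemma bine_game_best_choice_game:
  assumes "bine_game (N + 1) J I"
  shows "best_choice_game (N + 1) I"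
proof -
  define R where "R = (\<lambda>(\<pi>, i) \<sigma>. \<sigma> \<in> perms (N + 1)
    \<and> prefix_pattern i \<sigma> = prefix_pattern i \<pi> \<and> \<sigma> ! (i - 1) = N + 1)"
  have rel: "rel_mset R (bine_pairs (N + 1) J) I" and "J \<noteq> {#}"
    using assms by (auto simp: bine_game_def R_def)
  then obtain \<pi> J' where J: "J = add_mset \<pi> J'" by (meson multiset_cases)
  \<comment> \<open>Position 1 is always a left-to-right maximum position, so a competitor
    contributes at least one pair and the game is nonempty.\<close>
  have "1 \<in> ltr_max_positions (\<pi> @ [N + 1])" "finite (ltr_max_positions (\<pi> @ [N + 1]))"
    using ltr_max_positions_subset finite_subset by (auto simp: ltr_max_positions_def)
  then have "bine_pairs (N + 1) J \<noteq> {#}"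
    by (auto simp: bine_pairs_def J mset_set_empty_iff)
  moreover have "\<sigma> \<in> perms (N + 1)" if "\<sigma> \<in># I" for \<sigma>
    using rel_mset_memberD[OF rel that] by (auto simp: R_def)
  ultimately show ?thesis
    using rel_mset_size[OF rel] by (auto simp: best_choice_game_def)
qed

text \<open>Games and wins are both counted on the pairs: a competitor yields one pair for each of
  its maxima and one more for the appended N + 1, and exactly one of these pairs wins.\<close>

lemma strike_win_prob_bine_game:
  assumes game: "bine_game (N + 1) J I" and A: "maximal_antichain (N + 1) A"
  shows "strike_win_prob (N + 1) I A = real (size J) / (\<Sum>\<pi>\<in>#J. real (num_ltr_max \<pi>) + 1)"
proof -
  define R where "R = (\<lambda>(\<pi>, i) \<sigma>. \<sigma> \<in> perms (N + 1)
    \<and> prefix_pattern i \<sigma> = prefix_pattern i \<pi> \<and> \<sigma> ! (i - 1) = N + 1)"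
  have rel: "rel_mset R (bine_pairs (N + 1) J) I" and J: "J \<noteq> {#}" "set_mset J \<subseteq> perms N"
    using game by (auto simp: bine_game_def R_def)
  have ltr: "ltr_max_positions (\<pi> @ [N + 1]) = insert (N + 1) (ltr_max_positions \<pi>)"
      "\<pi> @ [N + 1] \<in> perms (N + 1)" "ltr_max_positions \<pi> \<subseteq> {1..N}" if "\<pi> \<in># J" for \<pi>
  proof -
    have p: "\<pi> \<in> perms N" using that J by auto
    have "x < N + 1" if "x \<in> set \<pi>" for x using permutations_of_setD(1)[OF p] that by auto
    from ltr_max_positions_snoc_max[OF this]
    show "ltr_max_positions (\<pi> @ [N + 1]) = insert (N + 1) (ltr_max_positions \<pi>)"
      using perms_length[OF p] by simp
    show "\<pi> @ [N + 1] \<in> perms (N + 1)" by (rule snoc_perm[OF p])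
    show "ltr_max_positions \<pi> \<subseteq> {1..N}" using ltr_max_positions_subset[of \<pi>] perms_length[OF p] by simp
  qed
  have "size I = size (bine_pairs (N + 1) J)" using rel_mset_size[OF rel] by simp
  also have "\<dots> = (\<Sum>\<pi>\<in>#J. card (ltr_max_positions (\<pi> @ [N + 1])))"
    using size_filter_bine_pairs[of "\<lambda>_. True" "N + 1" J] by simp
  also have "\<dots> = (\<Sum>\<pi>\<in>#J. num_ltr_max \<pi> + 1)"
  proof (intro arg_cong[of _ _ sum_mset] image_mset_cong)
    fix \<pi> assume "\<pi> \<in># J"
    note l = ltr[OF this]
    have "finite (ltr_max_positions \<pi>)" "N + 1 \<notin> ltr_max_positions \<pi>" using l(3) finite_subset by auto
    then show "card (ltr_max_positions (\<pi> @ [N + 1])) = num_ltr_max \<pi> + 1"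
      unfolding l(1) num_ltr_max_def by simp
  qed
  finally have sizeI: "size I = (\<Sum>\<pi>\<in>#J. num_ltr_max \<pi> + 1)" .
  have "I \<noteq> {#}" using bine_game_best_choice_game[OF game] by (simp add: best_choice_game_def)
  define P where "P = (\<lambda>(\<pi>, i). prefix_pattern i \<pi> \<in> A)"
  \<comment> \<open>Whether a permutation wins depends only on its prefix of size \<open>i\<close>,
    which it shares with the competitor; this is why the free choices in the game do not
    matter.\<close>
  have "size (filter_mset (wins (N + 1) A) I) = size (filter_mset P (bine_pairs (N + 1) J))"
  proof (rule rel_mset_size_filter[OF rel, symmetric])
    fix x \<sigma> assume x: "x \<in># bine_pairs (N + 1) J" "R x \<sigma>"
    obtain \<pi> i where [simp]: "x = (\<pi>, i)" by force
    from x(1) obtain \<pi>' where \<pi>': "\<pi>' \<in># J" "\<pi> = \<pi>' @ [N + 1]" "i \<in> ltr_max_positions \<pi>"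
      using bine_pairs_memberD[of \<pi> i "N + 1" J] by auto
    then have "i \<in> {1..N + 1}" using ltr[OF \<pi>'(1)] by auto
    then show "P x \<longleftrightarrow> wins (N + 1) A \<sigma>"
      using x(2) wins_iff_prefix_in_antichain[OF A, of \<sigma> i] by (auto simp: R_def P_def)
  qed
  also have "\<dots> = (\<Sum>\<pi>\<in>#J. 1)"
    unfolding size_filter_bine_pairs P_def prod.case
  proof (intro arg_cong[of _ _ sum_mset] image_mset_cong)
    fix \<pi> assume "\<pi> \<in># J"
    then have "\<pi> @ [N + 1] \<in> perms (N + 1)" "N + 1 \<in> ltr_max_positions (\<pi> @ [N + 1])"
      by (simp_all only: ltr insertI1)
    then show "card {i \<in> ltr_max_positions (\<pi> @ [N + 1]). prefix_pattern i (\<pi> @ [N + 1]) \<in> A} = 1"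
      by (intro maximal_antichain_meets[OF A]) simp_all
  qed
  also have "\<dots> = size J" by simp
  finally have wins: "size (filter_mset (wins (N + 1) A) I) = size J" .
  have "real (size I) = (\<Sum>\<pi>\<in>#J. real (num_ltr_max \<pi>) + 1)"
    unfolding sizeI by (induction J) auto
  then show ?thesis
    unfolding strike_win_prob_def using measure_pmf_of_multiset[OF \<open>I \<noteq> {#}\<close>] wins by simp
qed

lemma bine_game_strategy_indifferent:
  assumes "bine_game (N + 1) J I"
  shows "strategy_indifferent (N + 1) I"
    and "win_probability (N + 1) I = real (size J) / (\<Sum>\<pi>\<in>#J. real (num_ltr_max \<pi>) + 1)"
proof -
  let ?w = "real (size J) / (\<Sum>\<pi>\<in>#J. real (num_ltr_max \<pi>) + 1)"
  have eq: "strike_win_prob (N + 1) I A = ?w" if "maximal_antichain (N + 1) A" for A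
    using strike_win_prob_bine_game[OF assms that] .
  show "win_probability (N + 1) I = ?w"
    unfolding win_probability_def using eq maximal_antichain_singleton[of "N + 1"]
    by (intro the_equality) auto
  show "strategy_indifferent (N + 1) I"
    using eq bine_game_best_choice_game[OF assms] unfolding strategy_indifferent_def by blast
qed

text \<open>With mean (N + 1) / 2 the win probability is 1 / ((N + 1) / 2 + 1).\<close>

lemma bine_game_avoiders:
  assumes "\<rho> \<in> {[3,2,1], [3,1,2]}" "N \<ge> 1"
    and game: "bine_game (N + 1) (mset_set (avoiders \<rho> N)) I"
  shows "win_probability (N + 1) I = 2 / (real N + 3)"
proof -
  let ?S = "avoiders \<rho> N"
  have "card ?S \<noteq> 0" using avoiders_nonempty[OF assms(1,2)] by simp
  moreover have "(\<Sum>\<pi>\<in>#mset_set ?S. real (num_ltr_max \<pi>) + 1) = (\<Sum>\<pi>\<in>?S. real (num_ltr_max \<pi>) + 1)"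
    by (simp add: sum_unfold_sum_mset)
  moreover have "\<dots> = real (card ?S) * ((real N + 3) / 2)"
    by (simp add: sum.distrib sum_num_ltr_max_avoiders[OF assms(1,2)] field_simps)
  ultimately have "win_probability (N + 1) I = real (card ?S) / (real (card ?S) * ((real N + 3) / 2))"
    by (simp only: bine_game_strategy_indifferent(2)[OF game] size_mset_set)
  then show ?thesis using \<open>card ?S \<noteq> 0\<close> by simp
qed

theorem mainTheorem11:
  fixes \<rho> :: "nat list"
  assumes "\<rho> \<in> {[3,2,1], [3,1,2]}"
  shows "(\<forall>N\<ge>1. \<forall>k\<in>{1..N}.
             real (card {\<pi> \<in> avoiders \<rho> N. num_ltr_max \<pi> = k}) = narayana N k)
       \<and> (\<forall>N\<ge>1.
             measure_pmf.expectation (pmf_of_set (avoiders \<rho> N)) (\<lambda>\<pi>. real (num_ltr_max \<pi>))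
               = (2 * real N - 1) * catalan (N - 1) / catalan N
           \<and> (2 * real N - 1) * catalan (N - 1) / catalan N = (real N + 1) / 2)
       \<and> (\<forall>\<G> :: nat \<Rightarrow> nat list multiset.
             (\<forall>N\<ge>1. bine_game (N + 1) (mset_set (avoiders \<rho> N)) (\<G> N)) \<longrightarrow>
               (\<forall>N\<ge>1. strategy_indifferent (N + 1) (\<G> N))
             \<and> (\<lambda>N. win_probability (N + 1) (\<G> N)) \<longlonglongrightarrow> 0)"
proof (intro conjI allI impI ballI)
  fix N k :: nat assume "k \<in> {1..N}"
  then show "real (card {\<pi> \<in> avoiders \<rho> N. num_ltr_max \<pi> = k}) = narayana N k"
    by (rule card_avoiders_num_ltr_max[OF assms])
next
  fix N :: nat assume N: "N \<ge> 1"
  show ratio: "(2 * real N - 1) * catalan (N - 1) / catalan N = (real N + 1) / 2"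
    by (rule catalan_ratio[OF N])
  show "measure_pmf.expectation (pmf_of_set (avoiders \<rho> N)) (\<lambda>\<pi>. real (num_ltr_max \<pi>))
      = (2 * real N - 1) * catalan (N - 1) / catalan N"
    unfolding ratio by (rule expectation_num_ltr_max_avoiders[OF assms N])
next
  fix \<G> :: "nat \<Rightarrow> nat list multiset" and N :: nat
  assume "\<forall>N\<ge>1. bine_game (N + 1) (mset_set (avoiders \<rho> N)) (\<G> N)" "N \<ge> 1"
  then show "strategy_indifferent (N + 1) (\<G> N)"
    using bine_game_strategy_indifferent(1) by blast
next
  fix \<G> :: "nat \<Rightarrow> nat list multiset"
  assume "\<forall>N\<ge>1. bine_game (N + 1) (mset_set (avoiders \<rho> N)) (\<G> N)"
  \<comment> \<open>The games are constrained only for N >= 1, so the closed form holds eventually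
    rather than everywhere.\<close>
  then have "\<forall>\<^sub>F N in sequentially. 2 / (real N + 3) = win_probability (N + 1) (\<G> N)"
    using bine_game_avoiders[OF assms] by (intro eventually_sequentiallyI[of 1]) auto
  moreover have "(\<lambda>N. 2 / (real N + 3)) \<longlonglongrightarrow> 0"
    by real_asymp
  ultimately show "(\<lambda>N. win_probability (N + 1) (\<G> N)) \<longlonglongrightarrow> 0"
    by (rule Lim_transform_eventually[rotated])
qed

end
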